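(* For any $b,b'\in B$ with $b\neq b'$, $P_{\mathrm{SCF}}(b)$ and $P_{\mathrm{SCF}}(b')$ are not comparable, i.e. neither of them is contained in the other.
   Context: Let $n\ge 4$, $N=\{1,\dots,n\}$, $A=\{ij : i,j\in N,\ i\ne j\}$, $N_1=N\setminus\{1\}$. For $i\in N$, $\delta^+(i)$ is the set of arcs of $A$ leaving $i$ and $\delta^-(i)$ the set of arcs of $A$ entering $i$. $P_{\mathrm{AP}}$ is the set of $x\in[0,1]^A$ with $\sum_{j\neq i}x_{ij}=1$ and $\sum_{j\ne i}x_{ji}=1$ for all $i\in N$. $B=\{b\in\mathbb R_{++}^{N_1} : \sum_{i\in N_1}b_i=1\}$, where $\mathbb R_{++}$ denotes the positive reals (and $\mathbb R_+$ the nonnegative reals). For $b\in B$, $P_{\mathrm{SCF}}(b)$ is the projection onto the $x$ variables of the set $Q_{\mathrm{SCF}}(b)$ of $(x,f)\in P_{\mathrm{AP}}\times\mathbb R^A_+$ with $$\sum_{ij\in\delta^+(i)}f_{ij}-\sum_{ji\in\delta^-(i)}f_{ji}=-b_i\ \text{ for all } i\in N_1,\qquad f_{ij}\le x_{ij}\ \text{ for all } ij\in A.$$ *)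

theory Defs
  imports Complex_Main "HOL-Library.FuncSet"
begin

text \<open>
  A vector indexed by a finite set \<open>I\<close> is a function in \<open>I \<rightarrow>\<^sub>E UNIV\<close>: it is
  \<open>undefined\<close> outside \<open>I\<close>, so equality of such functions is equality of vectors.
  The arc \<open>ij\<close> is the pair \<open>(i, j)\<close>.
\<close>

definition nodes :: "nat \<Rightarrow> nat set" where
  "nodes n = {1..n}"

definition nodes1 :: "nat \<Rightarrow> nat set" where
  "nodes1 n = nodes n - {1}"

definition arcs :: "nat \<Rightarrow> (nat \<times> nat) set" where
  "arcs n = {(i, j). i \<in> nodes n \<and> j \<in> nodes n \<and> i \<noteq> j}"

definition out_arcs :: "nat \<Rightarrow> nat \<Rightarrow> (nat \<times> nat) set" where
  "out_arcs n i = {a \<in> arcs n. fst a = i}"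

definition in_arcs :: "nat \<Rightarrow> nat \<Rightarrow> (nat \<times> nat) set" where
  "in_arcs n i = {a \<in> arcs n. snd a = i}"

definition P_AP :: "nat \<Rightarrow> (nat \<times> nat \<Rightarrow> real) set" where
  "P_AP n = {x \<in> arcs n \<rightarrow>\<^sub>E {0..1}.
     \<forall>i\<in>nodes n. (\<Sum>j\<in>nodes n - {i}. x (i, j)) = 1 \<and> (\<Sum>j\<in>nodes n - {i}. x (j, i)) = 1}"

definition B :: "nat \<Rightarrow> (nat \<Rightarrow> real) set" where
  "B n = {b \<in> nodes1 n \<rightarrow>\<^sub>E {0<..}. (\<Sum>i\<in>nodes1 n. b i) = 1}"

definition Q_SCF ::
  "nat \<Rightarrow> (nat \<Rightarrow> real) \<Rightarrow> ((nat \<times> nat \<Rightarrow> real) \<times> (nat \<times> nat \<Rightarrow> real)) set" where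
  "Q_SCF n b = {(x, f). x \<in> P_AP n \<and> f \<in> arcs n \<rightarrow>\<^sub>E {0..} \<and>
     (\<forall>i\<in>nodes1 n. (\<Sum>a\<in>out_arcs n i. f a) - (\<Sum>a\<in>in_arcs n i. f a) = - b i) \<and>
     (\<forall>a\<in>arcs n. f a \<le> x a)}"

definition P_SCF :: "nat \<Rightarrow> (nat \<Rightarrow> real) \<Rightarrow> (nat \<times> nat \<Rightarrow> real) set" where
  "P_SCF n b = fst ` Q_SCF n b"

end

theory Submission
  imports Defs "HOL-Combinatorics.Permutations"
begin

text \<open>
  Since \<open>b\<close> and \<open>b'\<close> have the same total, each of them exceeds the other at some node, so by
  symmetry it suffices to exhibit, for a node \<open>j\<close> with \<open>b' j < b j\<close>, a point of \<open>P_SCF n b\<close> outside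
  \<open>P_SCF n b'\<close>. Summing flow conservation over a set \<open>S\<close> of nodes other than \<open>1\<close> shows that
  the capacity \<open>x\<close> entering \<open>S\<close> is at least the demand of \<open>S\<close> (lemma \<open>demand_le_entering_capacity\<close>).
  The idea is to make this cut tight for \<open>b\<close> at a set whose demand under \<open>b'\<close> is larger, namely
  \<open>S = nodes1 n - {j}\<close>. A singleton would not do, as the assignment equations fix
  its entering capacity to be \<open>1\<close>; but \<open>S\<close> has at least two elements because \<open>n \<ge> 4\<close>.

  The demands can be permuted among the nodes other than \<open>1\<close> (lemma \<open>P_SCF_permute\<close>), so let
  \<open>j = n\<close> and \<open>s = 1 - b n\<close>. The separating point mixes, with weights \<open>s\<close> and \<open>1 - s\<close>, the Hamiltonian
  tour \<open>1 \<rightarrow> 2 \<rightarrow> \<dots> \<rightarrow> n \<rightarrow> 1\<close> and the pair of disjoint cycles \<open>1 \<rightarrow> n \<rightarrow> 1\<close> and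
  \<open>2 \<rightarrow> \<dots> \<rightarrow> n - 1 \<rightarrow> 2\<close>. Only the tour enters \<open>S = {2..n - 1}\<close>, and only once, so the entering
  capacity is exactly \<open>s\<close>, the demand of \<open>S\<close> under \<open>b\<close> and less than its demand under \<open>b'\<close>.
  On the other hand the point is feasible for \<open>b\<close>: node \<open>n\<close> is supplied directly along \<open>(1, n)\<close>, and
  the nodes of \<open>S\<close> along the path \<open>1 \<rightarrow> 2 \<rightarrow> \<dots> \<rightarrow> n - 1\<close>.
\<close>

section \<open>Sums over arcs and the cut bound\<close>

lemma finite_nodes [simp]: "finite (nodes n)" "finite (nodes1 n)"
  by (simp_all add: nodes_def nodes1_def)

lemma sum_out_arcs:
  assumes "i \<in> nodes n"
  shows "(\<Sum>a\<in>out_arcs n i. f a) = (\<Sum>j\<in>nodes n - {i}. f (i, j))"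
  by (rule sum.reindex_bij_witness[of _ "\<lambda>j. (i, j)" snd])
     (use assms in \<open>auto simp: out_arcs_def arcs_def\<close>)

lemma sum_in_arcs:
  assumes "i \<in> nodes n"
  shows "(\<Sum>a\<in>in_arcs n i. f a) = (\<Sum>j\<in>nodes n - {i}. f (j, i))"
  by (rule sum.reindex_bij_witness[of _ "\<lambda>j. (j, i)" fst])
     (use assms in \<open>auto simp: in_arcs_def arcs_def\<close>)

text \<open>
  The easy half of max-flow min-cut: the flow on arcs inside \<open>S\<close> cancels when conservation is
  summed over \<open>S\<close>, and dropping the flow that leaves \<open>S\<close> only increases the net inflow.
\<close>

lemma demand_le_entering_capacity:
  assumes Q: "(x, f) \<in> Q_SCF n b" and S: "S \<subseteq> nodes1 n"
  shows "sum b S \<le> (\<Sum>u\<in>nodes n - S. \<Sum>v\<in>S. x (u, v))"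
proof -
  \<comment> \<open>Extending by zero to the diagonal makes the double sums symmetric, so that they cancel.\<close>
  define F where "F u v = (if u = v then 0 else f (u, v))" for u v
  let ?N = "nodes n"
  have SN: "S \<subseteq> ?N" "finite S"
    using S finite_subset[OF S] by (auto simp: nodes1_def)
  have f0: "f a \<ge> 0" and fx: "f a \<le> x a" if "a \<in> arcs n" for a
    using Q that PiE_mem[of f "arcs n" "\<lambda>_. {0..}" a] by (auto simp: Q_SCF_def)
  have F0: "F u v \<ge> 0" if "u \<in> ?N" "v \<in> ?N" for u v
    using f0 that by (auto simp: F_def arcs_def)
  have out: "(\<Sum>j\<in>?N - {i}. f (i, j)) = (\<Sum>j\<in>?N. F i j)"
    and "in": "(\<Sum>j\<in>?N - {i}. f (j, i)) = (\<Sum>j\<in>?N. F j i)" for i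
    by (auto intro!: sum.mono_neutral_cong_left simp: F_def split: if_splits)
  have b: "b i = (\<Sum>u\<in>?N. F u i) - (\<Sum>u\<in>?N. F i u)" if "i \<in> S" for i
  proof -
    have i: "i \<in> nodes1 n" "i \<in> ?N" using that S SN by auto
    with Q have "(\<Sum>a\<in>out_arcs n i. f a) - (\<Sum>a\<in>in_arcs n i. f a) = - b i"
      by (auto simp: Q_SCF_def)
    then show ?thesis
      using i by (simp add: sum_out_arcs sum_in_arcs out "in")
  qed
  have split: "sum h ?N = sum h (?N - S) + sum h S" for h :: "nat \<Rightarrow> real"
    using SN by (simp add: sum.subset_diff)
  have "sum b S = (\<Sum>i\<in>S. (\<Sum>u\<in>?N. F u i) - (\<Sum>u\<in>?N. F i u))"
    using b by simp
  also have "\<dots> = (\<Sum>i\<in>S. \<Sum>u\<in>?N - S. F u i) + (\<Sum>i\<in>S. \<Sum>u\<in>S. F u i)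
      - ((\<Sum>i\<in>S. \<Sum>u\<in>?N - S. F i u) + (\<Sum>i\<in>S. \<Sum>u\<in>S. F i u))"
    unfolding split by (simp add: sum.distrib sum_subtractf)
  also have "\<dots> = (\<Sum>i\<in>S. \<Sum>u\<in>?N - S. F u i) - (\<Sum>i\<in>S. \<Sum>u\<in>?N - S. F i u)"
    using sum.swap[of F S S] by simp
  also have "\<dots> \<le> (\<Sum>i\<in>S. \<Sum>u\<in>?N - S. F u i)"
    using SN F0 by (auto intro!: sum_nonneg)
  also have "\<dots> = (\<Sum>u\<in>?N - S. \<Sum>i\<in>S. F u i)"
    by (rule sum.swap)
  also have "\<dots> \<le> (\<Sum>u\<in>?N - S. \<Sum>v\<in>S. x (u, v))"
    using SN fx by (intro sum_mono) (auto simp: F_def arcs_def)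
  finally show ?thesis .
qed

section \<open>Permuting the nodes\<close>

text \<open>
  A permutation fixes everything outside its carrier, so composing with it preserves the convention
  that vectors are undefined outside their index set.
\<close>

lemma PiE_comp_permutes:
  assumes "p permutes A" "x \<in> A \<rightarrow>\<^sub>E C"
  shows "x \<circ> p \<in> A \<rightarrow>\<^sub>E C"
  using assms permutes_in_image[OF assms(1)]
  by (auto simp: PiE_def Pi_def extensional_def)

lemma map_prod_in_arcs_iff:
  assumes p: "p permutes nodes n"
  shows "map_prod p p a \<in> arcs n \<longleftrightarrow> a \<in> arcs n"
  using permutes_in_image[OF p] permutes_inj[OF p]
  by (cases a) (auto simp: arcs_def inj_eq)

lemma PiE_arcs_comp:
  assumes p: "p permutes nodes n" and x: "x \<in> arcs n \<rightarrow>\<^sub>E C"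
  shows "x \<circ> map_prod p p \<in> arcs n \<rightarrow>\<^sub>E C"
  using x map_prod_in_arcs_iff[OF p]
  by (auto simp: PiE_def Pi_def extensional_def simp del: map_prod_simp split_paired_All)

lemma sum_nodes_permute:
  assumes p: "p permutes nodes n"
  shows "(\<Sum>j\<in>nodes n - {i}. h (p j)) = (\<Sum>j\<in>nodes n - {p i}. h j)"
proof (rule sum.reindex_bij_betw)
  have "p ` (nodes n - {i}) = nodes n - {p i}"
    using permutes_image[OF p] permutes_inj[OF p] by (simp add: image_set_diff)
  then show "bij_betw p (nodes n - {i}) (nodes n - {p i})"
    using permutes_inj_on[OF p] by (auto simp: bij_betw_def intro: inj_on_subset)
qed

text \<open>
  The model treats all nodes other than \<open>1\<close> alike, so relabelling them in a feasible pair \<open>(x, f)\<close>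
  only relabels the demands. This is what allows the separating point to be written down for
  a single choice of the special node.
\<close>

lemma P_SCF_permute:
  assumes p: "p permutes nodes1 n" and x: "x \<in> P_SCF n b"
  shows "x \<circ> map_prod p p \<in> P_SCF n (b \<circ> p)"
proof -
  from x obtain f where Q: "(x, f) \<in> Q_SCF n b" by (auto simp: P_SCF_def)
  have pN: "p permutes nodes n"
    using p by (rule permutes_subset) (auto simp: nodes1_def)
  have N1N: "nodes1 n \<subseteq> nodes n" by (auto simp: nodes1_def)
  let ?x = "x \<circ> map_prod p p" and ?f = "f \<circ> map_prod p p"
  have "?x \<in> P_AP n"
    using Q PiE_arcs_comp[OF pN] permutes_in_image[OF pN]
      sum_nodes_permute[OF pN, of "\<lambda>j. x (p i, j)" i for i]
      sum_nodes_permute[OF pN, of "\<lambda>j. x (j, p i)" i for i]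
    by (auto simp: Q_SCF_def P_AP_def)
  moreover have "?f \<in> arcs n \<rightarrow>\<^sub>E {0..}"
    using Q by (intro PiE_arcs_comp[OF pN]) (auto simp: Q_SCF_def)
  moreover have "(\<Sum>a\<in>out_arcs n i. ?f a) - (\<Sum>a\<in>in_arcs n i. ?f a) = - (b \<circ> p) i"
    if i: "i \<in> nodes1 n" for i
  proof -
    have pi: "p i \<in> nodes1 n" using i permutes_in_image[OF p] by simp
    with Q have "(\<Sum>a\<in>out_arcs n (p i). f a) - (\<Sum>a\<in>in_arcs n (p i). f a) = - b (p i)"
      by (auto simp: Q_SCF_def)
    with i pi N1N show ?thesis
      using sum_nodes_permute[OF pN, of "\<lambda>j. f (p i, j)" i]
        sum_nodes_permute[OF pN, of "\<lambda>j. f (j, p i)" i]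
      by (auto simp: sum_out_arcs sum_in_arcs subset_iff)
  qed
  moreover have "\<forall>a\<in>arcs n. ?f a \<le> ?x a"
    using Q map_prod_in_arcs_iff[OF pN] by (auto simp: Q_SCF_def)
  ultimately have "(?x, ?f) \<in> Q_SCF n (b \<circ> p)"
    by (auto simp: Q_SCF_def)
  then show ?thesis by (force simp: P_SCF_def)
qed

text \<open>Inclusions transfer because relabelling by the inverse permutation maps back.\<close>

lemma P_SCF_mono_permute:
  assumes p: "p permutes nodes1 n" and sub: "P_SCF n b \<subseteq> P_SCF n b'"
  shows "P_SCF n (b \<circ> p) \<subseteq> P_SCF n (b' \<circ> p)"
proof
  fix x assume "x \<in> P_SCF n (b \<circ> p)"
  from P_SCF_permute[OF permutes_inv[OF p] this]
  have "x \<circ> map_prod (inv p) (inv p) \<in> P_SCF n b"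
    by (simp add: comp_assoc permutes_inv_o[OF p])
  with sub have "x \<circ> map_prod (inv p) (inv p) \<in> P_SCF n b'" by blast
  from P_SCF_permute[OF p this] show "x \<in> P_SCF n (b' \<circ> p)"
    by (simp add: comp_assoc map_prod_compose[symmetric] permutes_inv_o[OF p] map_prod.id)
qed

lemma B_permute:
  assumes p: "p permutes nodes1 n" and b: "b \<in> B n"
  shows "b \<circ> p \<in> B n"
  using b PiE_comp_permutes[OF p] sum.permute[OF p, of b]
  by (auto simp: B_def)

section \<open>The separating point\<close>

definition perm_matrix_mix :: "nat \<Rightarrow> real \<Rightarrow> (nat \<Rightarrow> nat) \<Rightarrow> (nat \<Rightarrow> nat) \<Rightarrow> nat \<times> nat \<Rightarrow> real" where
  "perm_matrix_mix n s \<sigma> \<tau> =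
     (\<lambda>(u, v)\<in>arcs n. s * of_bool (v = \<sigma> u) + (1 - s) * of_bool (v = \<tau> u))"

lemma sum_row_derangement:
  assumes "bij_betw \<sigma> (nodes n) (nodes n)" "\<And>i. i \<in> nodes n \<Longrightarrow> \<sigma> i \<noteq> i" "i \<in> nodes n"
  shows "(\<Sum>j\<in>nodes n - {i}. of_bool (j = \<sigma> i) :: real) = 1"
  using assms by (auto simp: of_bool_def sum.delta bij_betw_def)

lemma sum_column_derangement:
  assumes "bij_betw \<sigma> (nodes n) (nodes n)" "\<And>i. i \<in> nodes n \<Longrightarrow> \<sigma> i \<noteq> i" "i \<in> nodes n"
  shows "(\<Sum>j\<in>nodes n - {i}. of_bool (i = \<sigma> j) :: real) = 1"
proof -
  have "(\<Sum>j\<in>nodes n - {i}. of_bool (i = \<sigma> j) :: real) = (\<Sum>j\<in>nodes n. of_bool (i = \<sigma> j))"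
    using assms(2)[OF assms(3)] by (intro sum.mono_neutral_left) auto
  also have "\<dots> = (\<Sum>k\<in>nodes n. of_bool (i = k))"
    by (rule sum.reindex_bij_betw[OF assms(1), of "\<lambda>k. of_bool (i = k)"])
  also have "\<dots> = 1"
    using assms(3) by (simp add: of_bool_def)
  finally show ?thesis .
qed

lemma perm_matrix_mix_in_P_AP:
  assumes s: "0 \<le> s" "s \<le> 1"
    and \<sigma>: "bij_betw \<sigma> (nodes n) (nodes n)" "\<And>i. i \<in> nodes n \<Longrightarrow> \<sigma> i \<noteq> i"
    and \<tau>: "bij_betw \<tau> (nodes n) (nodes n)" "\<And>i. i \<in> nodes n \<Longrightarrow> \<tau> i \<noteq> i"
  shows "perm_matrix_mix n s \<sigma> \<tau> \<in> P_AP n"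
proof -
  let ?x = "perm_matrix_mix n s \<sigma> \<tau>"
  have row: "(\<Sum>j\<in>nodes n - {i}. ?x (i, j)) = 1" if i: "i \<in> nodes n" for i
  proof -
    have "(\<Sum>j\<in>nodes n - {i}. ?x (i, j))
        = (\<Sum>j\<in>nodes n - {i}. s * of_bool (j = \<sigma> i) + (1 - s) * of_bool (j = \<tau> i))"
      using i by (intro sum.cong) (auto simp: perm_matrix_mix_def arcs_def)
    also have "\<dots> = 1"
      unfolding sum.distrib sum_distrib_left[symmetric]
      by (simp only: sum_row_derangement[OF \<sigma> i] sum_row_derangement[OF \<tau> i]) simp
    finally show ?thesis .
  qed
  have column: "(\<Sum>j\<in>nodes n - {i}. ?x (j, i)) = 1" if i: "i \<in> nodes n" for i
  proof -
    have "(\<Sum>j\<in>nodes n - {i}. ?x (j, i))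
        = (\<Sum>j\<in>nodes n - {i}. s * of_bool (i = \<sigma> j) + (1 - s) * of_bool (i = \<tau> j))"
      using i by (intro sum.cong) (auto simp: perm_matrix_mix_def arcs_def)
    also have "\<dots> = 1"
      unfolding sum.distrib sum_distrib_left[symmetric]
      by (simp only: sum_column_derangement[OF \<sigma> i] sum_column_derangement[OF \<tau> i]) simp
    finally show ?thesis .
  qed
  have "?x \<in> arcs n \<rightarrow>\<^sub>E {0..1}"
    using s by (auto simp: perm_matrix_mix_def of_bool_def)
  with row column show ?thesis by (simp add: P_AP_def)
qed

text \<open>
  The next two maps agree except that \<open>two_cycles\<close> replaces the arcs \<open>(1, 2)\<close> and \<open>(n - 1, n)\<close> of
  the tour by \<open>(1, n)\<close> and \<open>(n - 1, 2)\<close>. The new arc \<open>(n - 1, 2)\<close> is a loop when \<open>n = 3\<close>, which is why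
  four nodes are required.
\<close>

definition tour :: "nat \<Rightarrow> nat \<Rightarrow> nat" where
  "tour n u = (if u = n then 1 else Suc u)"

definition two_cycles :: "nat \<Rightarrow> nat \<Rightarrow> nat" where
  "two_cycles n u = (if u = 1 then n else if u = n then 1 else if u = n - 1 then 2 else Suc u)"

lemma bij_betw_tour: "n \<ge> 4 \<Longrightarrow> bij_betw (tour n) (nodes n) (nodes n)"
  by (rule bij_betw_byWitness[where f' = "\<lambda>v. if v = 1 then n else v - 1"])
     (auto simp: tour_def nodes_def)

lemma bij_betw_two_cycles: "n \<ge> 4 \<Longrightarrow> bij_betw (two_cycles n) (nodes n) (nodes n)"
  by (rule bij_betw_byWitness[where f' =
        "\<lambda>v. if v = 1 then n else if v = n then 1 else if v = 2 then n - 1 else v - 1"])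
     (auto simp: two_cycles_def nodes_def)

definition separator :: "nat \<Rightarrow> real \<Rightarrow> nat \<times> nat \<Rightarrow> real" where
  "separator n s = perm_matrix_mix n s (tour n) (two_cycles n)"

text \<open>
  The arc \<open>(u, u + 1)\<close> carries the demand of the nodes strictly between \<open>u\<close> and \<open>n\<close>. This is at most
  \<open>1 - b n\<close>, the capacity that the tour alone provides, while the cycle through \<open>1\<close> and \<open>n\<close>
  provides exactly the capacity \<open>b n\<close> needed on \<open>(1, n)\<close>.
\<close>

lemma separator_in_P_SCF:
  assumes n: "n \<ge> 4" and b: "b \<in> B n"
  shows "separator n (1 - b n) \<in> P_SCF n b"
proof -
  define s where "s = 1 - b n"
  define g where "g u = sum b {u<..<n}" for u
  define f where "f = (\<lambda>(u, v)\<in>arcs n. of_bool (v = Suc u) * g u + of_bool (u = 1 \<and> v = n) * b n)"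
  have N1: "nodes1 n = {2..n}" by (auto simp: nodes1_def nodes_def)
  have pos: "b i > 0" if "i \<in> {2..n}" for i
    using b that by (auto simp: B_def N1)
  have "{2..n} = insert n {1<..<n}" using n by auto
  then have sum_b: "g 1 + b n = 1"
    using b by (auto simp: B_def N1 g_def)
  have g0: "g u \<ge> 0" if "u \<ge> 1" for u
    unfolding g_def using pos that by (intro sum_nonneg) (auto intro: less_imp_le)
  have gs: "g u \<le> s" if "u \<ge> 1" for u
  proof -
    have "g u \<le> g 1"
      unfolding g_def using pos that by (intro sum_mono2) (auto intro: less_imp_le)
    with sum_b show ?thesis by (simp add: s_def)
  qed
  have bn: "b n > 0" using pos n by simp
  have s: "0 \<le> s" "s \<le> 1" using sum_b g0[of 1] bn by (auto simp: s_def)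
  have "separator n s \<in> P_AP n"
    unfolding separator_def
    by (rule perm_matrix_mix_in_P_AP[OF s bij_betw_tour[OF n] _ bij_betw_two_cycles[OF n]])
       (use n in \<open>auto simp: tour_def two_cycles_def\<close>)
  moreover have "f \<in> arcs n \<rightarrow>\<^sub>E {0..}"
    using g0 bn by (auto simp: f_def arcs_def nodes_def)
  moreover have "(\<Sum>a\<in>out_arcs n i. f a) - (\<Sum>a\<in>in_arcs n i. f a) = - b i"
    if i: "i \<in> nodes1 n" for i
  proof -
    have i2: "2 \<le> i" "i \<le> n" and iN: "i \<in> nodes n"
      using i by (auto simp: N1 nodes_def)
    have "(\<Sum>a\<in>out_arcs n i. f a) = (\<Sum>v\<in>nodes n - {i}. if v = Suc i then g i else 0)"
      unfolding sum_out_arcs[OF iN] using i2 iN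
      by (intro sum.cong) (auto simp: f_def arcs_def)
    also have "\<dots> = g i"
      \<comment> \<open>For \<open>i = n\<close> there is no next node, but then no demand is left either.\<close>
      using i2 by (auto simp: sum.delta nodes_def g_def)
    finally have out: "(\<Sum>a\<in>out_arcs n i. f a) = g i" .
    have "(\<Sum>a\<in>in_arcs n i. f a) =
        (\<Sum>u\<in>nodes n - {i}. (if u = i - 1 then g (i - 1) else 0)
           + (if u = 1 then of_bool (i = n) * b n else 0))"
      unfolding sum_in_arcs[OF iN] using i2 iN
      by (intro sum.cong) (auto simp: f_def arcs_def)
    also have "\<dots> = g (i - 1) + of_bool (i = n) * b n"
      using i2 by (auto simp: sum.distrib sum.delta nodes_def)
    also have "\<dots> = g i + b i"
    proof (cases "i = n")
      case True
      then show ?thesis by (simp add: g_def atLeastSucLessThan_greaterThanLessThan[symmetric])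
    next
      case False
      then have "{i - 1<..<n} = insert i {i<..<n}" using i2 by auto
      with False show ?thesis by (simp add: g_def)
    qed
    finally show ?thesis using out by simp
  qed
  moreover have "f a \<le> separator n s a" if a: "a \<in> arcs n" for a
  proof -
    obtain u v where uv: "a = (u, v)" by fastforce
    with a have "1 \<le> u" "u \<le> n" "1 \<le> v" "v \<le> n" "u \<noteq> v"
      by (auto simp: arcs_def nodes_def)
    with a uv n s gs[of u] show ?thesis
      by (auto simp: f_def separator_def perm_matrix_mix_def tour_def two_cycles_def s_def)
  qed
  ultimately have "(separator n s, f) \<in> Q_SCF n b"
    by (simp add: Q_SCF_def)
  then show ?thesis unfolding P_SCF_def s_def by force
qed

text \<open>
  The complement \<open>{1, n}\<close> of \<open>{2..n - 1}\<close> is closed under \<open>two_cycles\<close>, and the tour leaves it only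
  along \<open>(1, 2)\<close>. So \<open>{2..n - 1}\<close> receives capacity \<open>s\<close>, while its demand is \<open>1 - b n\<close>.
\<close>

lemma separator_notin_P_SCF:
  assumes n: "n \<ge> 4" and b: "b \<in> B n" and s: "s < 1 - b n"
  shows "separator n s \<notin> P_SCF n b"
proof
  assume "separator n s \<in> P_SCF n b"
  then obtain f where Q: "(separator n s, f) \<in> Q_SCF n b" by (auto simp: P_SCF_def)
  let ?S = "{2..n - 1}"
  have N1: "nodes1 n = insert n ?S" and cut: "nodes n - ?S = {1, n}"
    using n by (auto simp: nodes1_def nodes_def)
  have "1 - b n = sum b ?S"
    using b n N1 by (auto simp: B_def)
  also have "\<dots> \<le> (\<Sum>v\<in>?S. separator n s (1, v)) + (\<Sum>v\<in>?S. separator n s (n, v))"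
    using demand_le_entering_capacity[OF Q, of ?S] n N1 cut by auto
  also have "(\<Sum>v\<in>?S. separator n s (n, v)) = 0"
    using n by (intro sum.neutral)
      (auto simp: separator_def perm_matrix_mix_def tour_def two_cycles_def arcs_def nodes_def)
  also have "(\<Sum>v\<in>?S. separator n s (1, v)) = (\<Sum>v\<in>?S. if v = 2 then s else 0)"
    using n by (intro sum.cong)
      (auto simp: separator_def perm_matrix_mix_def tour_def two_cycles_def arcs_def nodes_def)
  also have "\<dots> = s"
    using n by (auto simp: sum.delta)
  finally show False using s by simp
qed

section \<open>Incomparability\<close>

text \<open>Vectors of equal total cannot be ordered entrywise unless they are equal.\<close>

lemma exists_smaller_entry:
  assumes b: "b \<in> B n" and b': "b' \<in> B n" and "b \<noteq> b'"
  obtains j where "j \<in> nodes1 n" "b' j < b j"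
proof (rule ccontr)
  assume "\<not> thesis"
  with that have le: "b i \<le> b' i" if "i \<in> nodes1 n" for i
    using \<open>i \<in> nodes1 n\<close> by force
  have "b i = b' i" if "i \<in> nodes1 n" for i
    by (rule sum_mono_inv[of b "nodes1 n" b']) (use that le b b' in \<open>auto simp: B_def\<close>)
  then have "b = b'"
    using b b' by (intro PiE_ext[of b "nodes1 n" "\<lambda>_. {0<..}" b']) (auto simp: B_def)
  with \<open>b \<noteq> b'\<close> show False ..
qed

lemma P_SCF_not_subset:
  assumes n: "n \<ge> 4" and b: "b \<in> B n" and b': "b' \<in> B n" and neq: "b \<noteq> b'"
  shows "\<not> P_SCF n b \<subseteq> P_SCF n b'"
proof
  assume sub: "P_SCF n b \<subseteq> P_SCF n b'"
  obtain j where j: "j \<in> nodes1 n" "b' j < b j"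
    using exists_smaller_entry[OF b b' neq] .
  define p where "p = transpose j n"
  have p: "p permutes nodes1 n"
    unfolding p_def using j n by (intro permutes_swap_id) (auto simp: nodes1_def nodes_def)
  have "separator n (1 - (b \<circ> p) n) \<in> P_SCF n (b \<circ> p)"
    by (rule separator_in_P_SCF[OF n B_permute[OF p b]])
  moreover have "separator n (1 - (b \<circ> p) n) \<notin> P_SCF n (b' \<circ> p)"
    by (rule separator_notin_P_SCF[OF n B_permute[OF p b']]) (simp add: p_def j)
  ultimately show False
    using P_SCF_mono_permute[OF p sub] by blast
qed

theorem proposition29:
  fixes n :: nat and b b' :: "nat \<Rightarrow> real"
  assumes "n \<ge> 4"
    and "b \<in> B n" and "b' \<in> B n" and "b \<noteq> b'"
  shows "\<not> P_SCF n b \<subseteq> P_SCF n b' \<and> \<not> P_SCF n b' \<subseteq> P_SCF n b"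
  using P_SCF_not_subset[of n b b'] P_SCF_not_subset[of n b' b] assms by auto

end
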